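(* Let $\Omega$ be an open and bounded subset of $\mathbb{R}^2$. There exist $p>2$ and a map $\psi\in W^{1,p}(\Omega,\mathbb{R}^2)$ that solves $$\operatorname{curl}(B(D\psi))=0\quad\text{in }\Omega$$ and such that for every nonempty open set $\mathcal{V}\subset\Omega$, $\psi$ is not of class $C^1$ on $\mathcal{V}$.
   Context: For $X\in\mathbb{R}^{2\times 2}$, with $\|\cdot\|$ the Euclidean (Hilbert–Schmidt) norm, the area function is $\mathcal{A}(X)=\sqrt{1+\|X\|^2+\det(X)^2}$, and $D\mathcal{A}(X)\in\mathbb{R}^{2\times 2}$ is its gradient. Put $J=\begin{pmatrix}0&1\\-1&0\end{pmatrix}$ and $$B(X)=X^TD\mathcal{A}(X)J-\mathcal{A}(X)J\in\mathbb{R}^{2\times 2}.$$ The curl of a $2\times 2$ matrix field $M$ is taken row by row in the sense of distributions: $(\operatorname{curl}M)_i=\partial_1M_{i2}-\partial_2M_{i1}$, $i=1,2$. (The equation $\operatorname{curl}(B(D\psi))=0$ is the inner variation equation for the area functional.) *)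

theory Defs
  imports "HOL-Analysis.Analysis"
begin

section \<open>Classical smoothness\<close>

text \<open>For open \<open>U\<close> this is membership in \<open>C\<^sup>k(U)\<close>.\<close>

primrec Ck_on :: "nat \<Rightarrow> 'a::real_normed_vector set \<Rightarrow> ('a \<Rightarrow> 'b::real_normed_vector) \<Rightarrow> bool" where
  "Ck_on 0 U f \<longleftrightarrow> continuous_on U f"
| "Ck_on (Suc k) U f \<longleftrightarrow>
     (\<forall>x\<in>U. f differentiable (at x)) \<and>
     (\<forall>v. Ck_on k U (\<lambda>x. frechet_derivative f (at x) v))"

section \<open>Distributional derivatives and Sobolev functions\<close>

text \<open>Functions on \<open>\<Omega>\<close> are represented by total functions; every notion in this section
  ignores values outside \<open>\<Omega>\<close> and changes on null sets.\<close>

definition test_functions :: "(real^2) set \<Rightarrow> (real^2 \<Rightarrow> real) set" where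
  "test_functions \<Omega> =
     {\<phi>. (\<forall>k. Ck_on k UNIV \<phi>) \<and> compact (closure {x. \<phi> x \<noteq> 0}) \<and> closure {x. \<phi> x \<noteq> 0} \<subseteq> \<Omega>}"

definition partial_deriv :: "2 \<Rightarrow> (real^2 \<Rightarrow> real) \<Rightarrow> real^2 \<Rightarrow> real" where
  "partial_deriv j \<phi> x = frechet_derivative \<phi> (at x) (axis j 1)"

definition loc_integrable :: "(real^2) set \<Rightarrow> (real^2 \<Rightarrow> 'b::euclidean_space) \<Rightarrow> bool" where
  "loc_integrable \<Omega> f \<longleftrightarrow> (\<forall>K. compact K \<and> K \<subseteq> \<Omega> \<longrightarrow> f absolutely_integrable_on K)"

text \<open>The pairing of the distribution \<open>\<partial>\<^sub>j f\<close> on \<open>\<Omega>\<close> with a test function, for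
  locally integrable \<open>f\<close>.\<close>

definition dist_partial :: "(real^2) set \<Rightarrow> 2 \<Rightarrow> (real^2 \<Rightarrow> real) \<Rightarrow> (real^2 \<Rightarrow> real) \<Rightarrow> real" where
  "dist_partial \<Omega> j f \<phi> = - (LINT x:\<Omega>|lebesgue. f x * partial_deriv j \<phi> x)"

text \<open>The weak derivative \<open>G\<close> of \<open>u\<close>, with \<open>G\<^sub>i\<^sub>j = \<partial>\<^sub>j u\<^sub>i\<close>; it is unique up to a null set.\<close>

definition has_weak_jacobian ::
    "(real^2) set \<Rightarrow> (real^2 \<Rightarrow> real^2) \<Rightarrow> (real^2 \<Rightarrow> real^2^2) \<Rightarrow> bool" where
  "has_weak_jacobian \<Omega> u G \<longleftrightarrow>
     loc_integrable \<Omega> u \<and> loc_integrable \<Omega> G \<and>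
     (\<forall>\<phi>\<in>test_functions \<Omega>. \<forall>i j.
        dist_partial \<Omega> j (\<lambda>x. u x $ i) \<phi> = (LINT x:\<Omega>|lebesgue. G x $ i $ j * \<phi> x))"

definition Lp_on :: "real \<Rightarrow> (real^2) set \<Rightarrow> (real^2 \<Rightarrow> 'b::euclidean_space) set" where
  "Lp_on p \<Omega> = {f. f \<in> borel_measurable (lebesgue_on \<Omega>) \<and>
                   integrable (lebesgue_on \<Omega>) (\<lambda>x. norm (f x) powr p)}"

definition W1p :: "real \<Rightarrow> (real^2) set \<Rightarrow> (real^2 \<Rightarrow> real^2) set" where
  "W1p p \<Omega> = {u. u \<in> Lp_on p \<Omega> \<and> (\<exists>G. has_weak_jacobian \<Omega> u G \<and> G \<in> Lp_on p \<Omega>)}"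

text \<open>The \<open>i\<close>-th component of the row-wise distributional curl of a matrix field,
  paired with a test function.\<close>

definition dist_curl :: "(real^2) set \<Rightarrow> (real^2 \<Rightarrow> real^2^2) \<Rightarrow> 2 \<Rightarrow> (real^2 \<Rightarrow> real) \<Rightarrow> real" where
  "dist_curl \<Omega> M i \<phi> =
     dist_partial \<Omega> 1 (\<lambda>x. M x $ i $ 2) \<phi> - dist_partial \<Omega> 2 (\<lambda>x. M x $ i $ 1) \<phi>"

definition curl_free :: "(real^2) set \<Rightarrow> (real^2 \<Rightarrow> real^2^2) \<Rightarrow> bool" where
  "curl_free \<Omega> M \<longleftrightarrow>
     loc_integrable \<Omega> M \<and> (\<forall>\<phi>\<in>test_functions \<Omega>. \<forall>i. dist_curl \<Omega> M i \<phi> = 0)"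

text \<open>The almost-everywhere class of \<open>u\<close> has a representative of class \<open>C\<^sup>1\<close> on \<open>V\<close>.\<close>

definition ae_C1_on :: "(real^2) set \<Rightarrow> (real^2 \<Rightarrow> real^2) \<Rightarrow> bool" where
  "ae_C1_on V u \<longleftrightarrow> (\<exists>g. Ck_on 1 V g \<and> (AE x in lebesgue_on V. u x = g x))"

section \<open>The area function\<close>

text \<open>The norm of \<^typ>\<open>real^2^2\<close> is the Hilbert--Schmidt norm, and gradients are taken
  with respect to the corresponding inner product.\<close>

definition area :: "real^2^2 \<Rightarrow> real" where
  "area X = sqrt (1 + (norm X)\<^sup>2 + (det X)\<^sup>2)"

definition grad_area :: "real^2^2 \<Rightarrow> real^2^2" where
  "grad_area X = (THE D. GDERIV area X :> D)"

definition Jmat :: "real^2^2" where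
  "Jmat = vector [vector [0, 1], vector [-1, 0]]"

definition Bmap :: "real^2^2 \<Rightarrow> real^2^2" where
  "Bmap X = transpose X ** grad_area X ** Jmat - area X *\<^sub>R Jmat"

lemma inner_mat2: "(X::real^2^2) \<bullet> Y =
    X$1$1 * Y$1$1 + X$1$2 * Y$1$2 + X$2$1 * Y$2$1 + X$2$2 * Y$2$2"
  by (simp add: inner_vec_def sum_2)

lemma GDERIV_area_explicit:
  "GDERIV area X :> (1 / area X) *\<^sub>R
     (X + det X *\<^sub>R vector [vector [X$2$2, - X$2$1], vector [- X$1$2, X$1$1]])"
    (is "GDERIV area X :> (1 / area X) *\<^sub>R (X + det X *\<^sub>R ?C)")
proof -
  let ?q = "\<lambda>Y::real^2^2. 1 + Y \<bullet> Y + (det Y)\<^sup>2"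
  have pos: "0 < ?q X"
    by (simp add: add_pos_nonneg)
  have area: "area = (\<lambda>Y. sqrt (?q Y))"
    by (auto simp: area_def power2_norm_eq_inner)
  have comp: "((\<lambda>Y::real^2^2. Y$i$j) has_derivative (\<lambda>H. H$i$j)) (at X)" for i j
    by (intro bounded_linear_imp_has_derivative bounded_linear_compose[OF bounded_linear_vec_nth]
        bounded_linear_vec_nth)
  have C: "H \<bullet> ?C = X$1$1 * H$2$2 + H$1$1 * X$2$2 - (X$1$2 * H$2$1 + H$1$2 * X$2$1)" for H
    by (simp add: inner_mat2)
  have "(det has_derivative (\<lambda>H. H \<bullet> ?C)) (at X)"
    unfolding det_2[abs_def] C
    by (intro has_derivative_diff has_derivative_mult comp)
  then have q: "(?q has_derivative (\<lambda>H. 2 * (H \<bullet> X) + 2 * det X * (H \<bullet> ?C))) (at X)"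
    by (auto intro!: derivative_eq_intros simp: inner_commute)
  have sq: "(sqrt has_real_derivative inverse (sqrt (?q X)) / 2) (at (?q X))"
    using pos by (rule DERIV_real_sqrt)
  have "((\<lambda>Y. sqrt (?q Y)) has_derivative
      (\<lambda>H. (2 * (H \<bullet> X) + 2 * det X * (H \<bullet> ?C)) * (inverse (sqrt (?q X)) / 2))) (at X)"
    by (rule DERIV_compose_FDERIV[OF sq q])
  then show ?thesis
    unfolding gderiv_def area
    by (rule has_derivative_eq_rhs)
      (use pos in \<open>simp add: fun_eq_iff inner_add_right field_simps\<close>)
qed

lemma grad_area_eq:
  assumes "GDERIV area X :> D"
  shows "grad_area X = D"
  unfolding grad_area_def
proof (rule the_equality[where P = "\<lambda>D. GDERIV area X :> D", OF assms])
  fix E assume "GDERIV area X :> E"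
  with assms have "(\<lambda>h. h \<bullet> E) = (\<lambda>h. h \<bullet> D)"
    unfolding gderiv_def by (rule has_derivative_unique[rotated])
  then show "E = D"
    by (metis vector_eq_ldot)
qed

lemma GDERIV_area: "GDERIV area X :> grad_area X"
  using GDERIV_area_explicit grad_area_eq by metis

end

theory Submission
  imports Defs
begin

text \<open>
  With \<open>g = I + X\<^sup>T X\<close> one has \<open>B(X) = - J g / sqrt (det g)\<close>, so \<open>B\<close> only depends on the conformal
  class of the metric that the graph of an affine map induces. Let \<open>\<psi>(x) = \<gamma>(x\<^sub>1)\<close> for a
  unit-speed curve \<open>\<gamma>\<close> in the plane. Then \<open>g = diag(2, 1)\<close> almost everywhere and
  \<open>B(D\<psi>)\<close> is constant, however rough \<open>\<gamma>'\<close> is. Here \<open>\<gamma>' = (u, sqrt (1 - u\<^sup>2))\<close> with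
  \<open>u\<close> monotone, valued in \<open>[0, 1]\<close> and jumping at every rational: it is continuous off a countable
  set, which suffices for \<open>\<gamma>'\<close> to be the weak derivative, while the first component of \<open>\<gamma>\<close> is
  convex with a kink at every rational.
\<close>

section \<open>Integration by parts for Lipschitz functions\<close>

text \<open>The integrals of the difference quotients vanish by translation invariance, and the
  Lipschitz bound makes them converge dominatedly.\<close>

lemma lborel_integral_directional_derivative_eq_0:
  fixes F D :: "'a::euclidean_space \<Rightarrow> real"
  assumes cont: "continuous_on UNIV F"
    and K: "bounded K" "\<And>x. x \<notin> K \<Longrightarrow> F x = 0"
    and lip: "\<And>x t. \<bar>F (x + t *\<^sub>R e) - F x\<bar> \<le> L * \<bar>t\<bar>"
    and D: "D \<in> borel_measurable borel"
    and deriv: "AE x in lborel. ((\<lambda>t. F (x + t *\<^sub>R e)) has_real_derivative D x) (at 0)"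
  shows "(\<integral>x. D x \<partial>lborel) = 0"
proof -
  obtain r where "\<And>x. x \<in> K \<Longrightarrow> norm x \<le> r"
    using K(1) unfolding bounded_iff by auto
  then have F0: "F x = 0" if "r < norm x" for x
    using K(2)[of x] that by fastforce
  have L: "0 \<le> L"
    using lip[of 0 1] by simp
  \<comment> \<open>The increments are positive and at most 1, so each quotient is well defined and
    all of them are supported in one ball.\<close>
  define h :: "nat \<Rightarrow> real" where "h n = inverse (real (Suc n))" for n
  have h_pos: "0 < h n" and h_le: "h n \<le> 1" for n
    by (simp_all add: h_def inverse_le_1_iff)
  have h_lim: "h \<longlonglongrightarrow> 0"
    unfolding h_def by (rule LIMSEQ_inverse_real_of_nat)
  define s where "s n x = (F (x + h n *\<^sub>R e) - F x) / h n" for n x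
  have [measurable]: "F \<in> borel_measurable borel"
    using cont by (rule borel_measurable_continuous_onI)
  have "integrable lborel (\<lambda>x. indicator (cball 0 r) x *\<^sub>R F x)"
    by (rule borel_integrable_compact) (auto intro: continuous_on_subset[OF cont])
  moreover have "(\<lambda>x. indicator (cball 0 r) x *\<^sub>R F x) = F"
    using F0 by (auto simp: fun_eq_iff indicator_def)
  ultimately have F_int: "integrable lborel F"
    by simp
  have shift_int: "integrable lborel (\<lambda>x. F (x + c))" for c
    using integrable_distr[of "(+) c" lborel borel F] F_int
    by (simp add: lborel_distr_plus add.commute)
  have shift: "(\<integral>x. F (x + c) \<partial>lborel) = (\<integral>x. F x \<partial>lborel)" for c
    using integral_distr[of "(+) c" lborel borel F]
    by (simp add: lborel_distr_plus add.commute)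
  have s_int: "(\<integral>x. s n x \<partial>lborel) = 0" for n
    unfolding s_def using shift_int shift F_int by simp
  have "(\<lambda>n. \<integral>x. s n x \<partial>lborel) \<longlonglongrightarrow> (\<integral>x. D x \<partial>lborel)"
  proof (rule integral_dominated_convergence)
    show "D \<in> borel_measurable lborel" "s n \<in> borel_measurable lborel" for n
      using D by (simp_all add: s_def[abs_def])
    \<comment> \<open>The radius comes from the support: \<open>s n x\<close> can be nonzero only if
      \<open>x\<close> or \<open>x + h n *\<^sub>R e\<close> lies in \<open>cball 0 r\<close>, and
      since \<open>h n \<le> 1\<close> either case gives
      \<open>norm x \<le> r + norm e\<close>.\<close>
    show "integrable lborel (\<lambda>x. L * indicator (cball 0 (r + norm e)) x)"
      using emeasure_bounded_finite[OF bounded_cball, of 0 "r + norm e"]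
      by (intro integrable_mult_right integrable_real_indicator) simp_all
    show "AE x in lborel. (\<lambda>n. s n x) \<longlonglongrightarrow> D x"
      using deriv
    proof eventually_elim
      case (elim x)
      then have "((\<lambda>t. (F (x + t *\<^sub>R e) - F x) / t) \<longlongrightarrow> D x) (at 0)"
        by (simp add: has_field_derivative_iff)
      moreover have "filterlim h (at 0) sequentially"
        using h_lim by (simp add: filterlim_at h_def)
      ultimately show ?case
        unfolding s_def by (rule filterlim_compose)
    qed
    show "AE x in lborel. norm (s n x) \<le> L * indicator (cball 0 (r + norm e)) x" for n
    proof (rule AE_I2)
      fix x
      show "norm (s n x) \<le> L * indicator (cball 0 (r + norm e)) x"
      proof (cases "norm x \<le> r + norm e")
        case True
        then show ?thesis
          using lip[of x "h n"] h_pos[of n] by (simp add: s_def field_simps)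
      next
        case False
        have "norm x \<le> norm (x + h n *\<^sub>R e) + norm (h n *\<^sub>R e)"
          using norm_triangle_ineq4[of "x + h n *\<^sub>R e" "h n *\<^sub>R e"] by simp
        moreover have "norm (h n *\<^sub>R e) \<le> norm e"
          using h_pos[of n] h_le[of n] by (simp add: mult_left_le_one_le)
        ultimately have "r < norm (x + h n *\<^sub>R e)" "r < norm x"
          using False norm_ge_zero[of e] by linarith+
        then show ?thesis
          using F0 L by (simp add: s_def)
      qed
    qed
  qed
  then show ?thesis
    by (simp add: s_int LIMSEQ_const_iff)
qed

section \<open>Test functions: regularity, directional derivatives and support\<close>

lemma test_function_differentiable:
  assumes "\<phi> \<in> test_functions \<Omega>"
  shows "\<phi> differentiable (at x)"
proof -
  have "Ck_on (Suc 0) UNIV \<phi>"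
    using assms unfolding test_functions_def by blast
  then show ?thesis
    by simp
qed

lemma test_function_continuous:
  assumes "\<phi> \<in> test_functions \<Omega>"
  shows "continuous_on UNIV \<phi>"
  using assms unfolding test_functions_def by (metis (no_types, lifting) Ck_on.simps(1) mem_Collect_eq)

lemma test_function_continuous_partial_deriv:
  assumes "\<phi> \<in> test_functions \<Omega>"
  shows "continuous_on UNIV (partial_deriv j \<phi>)"
proof -
  have "Ck_on (Suc 0) UNIV \<phi>"
    using assms unfolding test_functions_def by blast
  then show ?thesis
    by (simp add: partial_deriv_def[abs_def])
qed

lemma test_function_partial_deriv:
  assumes "\<phi> \<in> test_functions \<Omega>"
  shows "((\<lambda>t. \<phi> (x + t *\<^sub>R axis j 1)) has_real_derivative
    partial_deriv j \<phi> (x + t *\<^sub>R axis j 1)) (at t)"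
proof -
  let ?y = "x + t *\<^sub>R axis j 1"
  have D: "(\<phi> has_derivative frechet_derivative \<phi> (at ?y)) (at ?y)"
    using test_function_differentiable[OF assms] frechet_derivative_works by blast
  have "((\<lambda>t. \<phi> (x + t *\<^sub>R axis j 1)) has_derivative
      (\<lambda>s. frechet_derivative \<phi> (at ?y) (s *\<^sub>R axis j 1))) (at t)"
    by (rule has_derivative_compose[where f = "\<lambda>t. x + t *\<^sub>R axis j 1" and g = \<phi>, OF _ D])
      (auto intro!: derivative_eq_intros)
  then show ?thesis
    using linear_scale[OF has_derivative_linear[OF D]]
    by (simp add: has_field_derivative_def partial_deriv_def mult_commute_abs)
qed

lemma test_function_partial_deriv_eq_0:
  assumes "\<phi> \<in> test_functions \<Omega>" "x \<notin> closure {x. \<phi> x \<noteq> 0}"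
  shows "partial_deriv j \<phi> x = 0"
proof -
  have "(\<phi> has_derivative (\<lambda>_. 0)) (at x)"
  proof (rule has_derivative_transform_within_open)
    show "((\<lambda>_. 0) has_derivative (\<lambda>_. 0)) (at x)" by simp
    show "open (- closure {x. \<phi> x \<noteq> 0})" "x \<in> - closure {x. \<phi> x \<noteq> 0}"
      using assms(2) by auto
    show "0 = \<phi> y" if "y \<in> - closure {x. \<phi> x \<noteq> 0}" for y
      using that closure_subset[of "{x. \<phi> x \<noteq> 0}"] by auto
  qed
  then show ?thesis
    unfolding partial_deriv_def by (metis frechet_derivative_at)
qed

text \<open>The indicator of \<open>\<Omega>\<close> is absorbed because \<open>h\<close> vanishes
  outside, and completing the measure does not change the integral of a Borel function.\<close>

lemma set_integral_lebesgue_eq_lborel: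
  fixes h :: "'a::euclidean_space \<Rightarrow> 'b::euclidean_space"
  assumes "h \<in> borel_measurable borel" "\<And>x. x \<notin> \<Omega> \<Longrightarrow> h x = 0"
  shows "(LINT x:\<Omega>|lebesgue. h x) = (\<integral>x. h x \<partial>lborel)"
proof -
  have "(\<lambda>x. indicat_real \<Omega> x *\<^sub>R h x) = h"
    using assms(2) by (auto simp: fun_eq_iff indicator_def)
  then show ?thesis
    unfolding set_lebesgue_integral_def using assms(1) by (simp add: integral_completion)
qed

lemma compact_support_bounded:
  fixes f :: "'a::metric_space \<Rightarrow> real"
  assumes "continuous_on UNIV f" "compact K" "\<And>x. x \<notin> K \<Longrightarrow> f x = 0"
  obtains M where "0 \<le> M" "\<And>x. \<bar>f x\<bar> \<le> M"
proof -
  have "compact (f ` K)"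
    using assms compact_continuous_image continuous_on_subset by blast
  then obtain M where M: "\<And>x. x \<in> K \<Longrightarrow> \<bar>f x\<bar> \<le> M"
    using compact_imp_bounded[of "f ` K"] unfolding bounded_iff by auto
  show thesis
  proof (rule that)
    show "0 \<le> max 0 M" by simp
    show "\<bar>f x\<bar> \<le> max 0 M" for x
      using M[of x] assms(3)[of x] by (cases "x \<in> K") auto
  qed
qed

text \<open>The product of \<open>f\<close> and \<open>\<phi>\<close> is Lipschitz in direction
  \<open>j\<close> with compact support, so the integral of its almost-everywhere derivative
  vanishes; the product rule splits this into the two sides.\<close>

lemma dist_partial_Lipschitz:
  fixes f d :: "real^2 \<Rightarrow> real"
  assumes cont: "continuous_on UNIV f"
    and lip: "\<And>x t. \<bar>f (x + t *\<^sub>R axis j 1) - f x\<bar> \<le> L * \<bar>t\<bar>"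
    and d: "d \<in> borel_measurable borel" "\<And>x. \<bar>d x\<bar> \<le> L"
    and deriv: "AE x in lborel. ((\<lambda>t. f (x + t *\<^sub>R axis j 1)) has_real_derivative d x) (at 0)"
    and \<phi>: "\<phi> \<in> test_functions \<Omega>"
  shows "dist_partial \<Omega> j f \<phi> = (LINT x:\<Omega>|lebesgue. d x * \<phi> x)"
proof -
  let ?e = "axis j 1 :: real^2"
  let ?p = "partial_deriv j \<phi>"
  define K where "K = closure {x. \<phi> x \<noteq> 0}"
  have K: "compact K" "K \<subseteq> \<Omega>"
    using \<phi> by (auto simp: test_functions_def K_def)
  have \<phi>0: "\<phi> x = 0" if "x \<notin> K" for x
    using that closure_subset[of "{x. \<phi> x \<noteq> 0}"] by (auto simp: K_def)
  have p0: "?p x = 0" if "x \<notin> K" for x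
    using that test_function_partial_deriv_eq_0[OF \<phi>] unfolding K_def by blast
  have \<phi>c: "continuous_on UNIV \<phi>" and pc: "continuous_on UNIV ?p"
    using \<phi> by (rule test_function_continuous, rule test_function_continuous_partial_deriv)
  have [measurable]: "f \<in> borel_measurable borel" "\<phi> \<in> borel_measurable borel"
      "?p \<in> borel_measurable borel" "d \<in> borel_measurable borel"
    using cont \<phi>c pc d by (auto intro: borel_measurable_continuous_onI)
  obtain M where M: "0 \<le> M" "\<And>x. \<bar>\<phi> x\<bar> \<le> M"
    using compact_support_bounded[OF \<phi>c K(1) \<phi>0] by blast
  obtain N where N: "0 \<le> N" "\<And>x. \<bar>?p x\<bar> \<le> N"
    using compact_support_bounded[OF pc K(1) p0] by blast
  \<comment> \<open>\<open>f\<close> may be unbounded on the whole plane, so a bound is taken on the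
    support \<open>K\<close> only.\<close>
  obtain P where P: "0 \<le> P" "\<And>x. x \<in> K \<Longrightarrow> \<bar>f x\<bar> \<le> P"
  proof -
    have "compact (f ` K)"
      using cont K compact_continuous_image continuous_on_subset by blast
    then obtain P where "\<And>x. x \<in> K \<Longrightarrow> \<bar>f x\<bar> \<le> P"
      using compact_imp_bounded[of "f ` K"] unfolding bounded_iff by auto
    then show thesis
      using that[of "max 0 P"] by (meson max.cobounded1 max.coboundedI2)
  qed
  have L: "0 \<le> L"
    using lip[of 0 1] by simp
  have \<phi>lip: "\<bar>\<phi> (x + t *\<^sub>R ?e) - \<phi> x\<bar> \<le> N * \<bar>t\<bar>" for x t
  proof -
    have "norm (\<phi> (x + t *\<^sub>R ?e) - \<phi> (x + 0 *\<^sub>R ?e)) \<le> N * norm (t - 0)"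
      by (rule field_differentiable_bound[where S = UNIV and f = "\<lambda>t. \<phi> (x + t *\<^sub>R ?e)"
            and f' = "\<lambda>t. ?p (x + t *\<^sub>R ?e)"])
        (use N test_function_partial_deriv[OF \<phi>] in auto)
    then show ?thesis by simp
  qed
  define F where "F x = f x * \<phi> x" for x
  have F1: "\<bar>F (x + t *\<^sub>R ?e) - F x\<bar> \<le> (P * N + L * M) * \<bar>t\<bar>" if "x \<in> K" for x t
  proof -
    \<comment> \<open>In this splitting \<open>f\<close> itself is evaluated only at
      \<open>x\<close>, the endpoint known to lie in \<open>K\<close>, so that \<open>P\<close>
      bounds it.\<close>
    have "F (x + t *\<^sub>R ?e) - F x = f x * (\<phi> (x + t *\<^sub>R ?e) - \<phi> x)
        + (f (x + t *\<^sub>R ?e) - f x) * \<phi> (x + t *\<^sub>R ?e)"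
      by (simp add: F_def algebra_simps)
    also have "\<bar>\<dots>\<bar> \<le> \<bar>f x * (\<phi> (x + t *\<^sub>R ?e) - \<phi> x)\<bar>
        + \<bar>(f (x + t *\<^sub>R ?e) - f x) * \<phi> (x + t *\<^sub>R ?e)\<bar>"
      by (rule abs_triangle_ineq)
    also have "\<dots> \<le> P * (N * \<bar>t\<bar>) + (L * \<bar>t\<bar>) * M"
      unfolding abs_mult using P that \<phi>lip lip M L
      by (intro add_mono mult_mono) auto
    finally show ?thesis by (simp add: algebra_simps)
  qed
  have F2: "\<bar>F (x + t *\<^sub>R ?e) - F x\<bar> \<le> (P * N + L * M) * \<bar>t\<bar>" for x t
  proof (cases "x \<in> K")
    case True
    then show ?thesis by (rule F1)
  next
    case x: False
    show ?thesis
    proof (cases "x + t *\<^sub>R ?e \<in> K")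
      case True
      \<comment> \<open>The increment is read backwards, from the endpoint that lies in
        \<open>K\<close>.\<close>
      from F1[OF this, of "-t"] show ?thesis
        by (simp add: abs_minus_commute)
    next
      case False
      then show ?thesis
        using x \<phi>0 P N L M by (simp add: F_def)
    qed
  qed
  have int: "integrable lborel (\<lambda>x. f x * ?p x)" "integrable lborel (\<lambda>x. d x * \<phi> x)"
  proof -
    have fin: "integrable lborel (\<lambda>x. C * indicator K x)" for C :: real
      using borel_compact[OF K(1)] emeasure_compact_finite[OF K(1)] by simp
    have 1: "\<bar>f x * ?p x\<bar> \<le> P * N * indicator K x" for x
      using p0[of x] P N by (cases "x \<in> K") (auto simp: abs_mult intro!: mult_mono)
    show "integrable lborel (\<lambda>x. f x * ?p x)"
      by (rule Bochner_Integration.integrable_bound[OF fin[of "P * N"]])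
        (use 1 P N in \<open>auto simp: abs_mult[of P] abs_mult[of "P * N"]\<close>)
    have 2: "\<bar>d x * \<phi> x\<bar> \<le> L * M * indicator K x" for x
      using \<phi>0[of x] d M L by (cases "x \<in> K") (auto simp: abs_mult intro!: mult_mono)
    show "integrable lborel (\<lambda>x. d x * \<phi> x)"
      by (rule Bochner_Integration.integrable_bound[OF fin[of "L * M"]])
        (use 2 L M in \<open>auto simp: abs_mult[of L] abs_mult[of "L * M"]\<close>)
  qed
  have "(\<integral>x. f x * ?p x + d x * \<phi> x \<partial>lborel) = 0"
  proof (rule lborel_integral_directional_derivative_eq_0[OF _ _ _ F2])
    show "continuous_on UNIV F"
      unfolding F_def using cont \<phi>c by (intro continuous_on_mult)
    show "bounded K" using K(1) by (rule compact_imp_bounded)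
    show "F x = 0" if "x \<notin> K" for x using \<phi>0[OF that] by (simp add: F_def)
    show "(\<lambda>x. f x * ?p x + d x * \<phi> x) \<in> borel_measurable borel" by measurable
    show "AE x in lborel. ((\<lambda>t. F (x + t *\<^sub>R ?e)) has_real_derivative
        f x * ?p x + d x * \<phi> x) (at 0)"
      using deriv
    proof eventually_elim
      case (elim x)
      from DERIV_mult[OF elim test_function_partial_deriv[OF \<phi>, of x j 0]]
      show ?case by (simp add: F_def algebra_simps)
    qed
  qed
  then have "- (\<integral>x. f x * ?p x \<partial>lborel) = (\<integral>x. d x * \<phi> x \<partial>lborel)"
    using int by simp
  moreover have "(LINT x:\<Omega>|lebesgue. f x * ?p x) = (\<integral>x. f x * ?p x \<partial>lborel)"
    by (rule set_integral_lebesgue_eq_lborel) (use p0 K in auto)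
  moreover have "(LINT x:\<Omega>|lebesgue. d x * \<phi> x) = (\<integral>x. d x * \<phi> x \<partial>lborel)"
    by (rule set_integral_lebesgue_eq_lborel) (use \<phi>0 K in auto)
  ultimately show ?thesis
    by (simp add: dist_partial_def)
qed

lemma dist_partial_const:
  assumes "\<phi> \<in> test_functions \<Omega>"
  shows "dist_partial \<Omega> j (\<lambda>_. c) \<phi> = 0"
proof -
  have "dist_partial \<Omega> j (\<lambda>_. c) \<phi> = (LINT x:\<Omega>|lebesgue. 0 * \<phi> x)"
    using assms by (intro dist_partial_Lipschitz[where L = 0]) auto
  then show ?thesis
    by (simp add: set_lebesgue_integral_def)
qed

section \<open>Convex functions with a dense set of kinks\<close>

text \<open>Enumerate the points and add a step of height \<open>(1/2)^Suc n\<close> at the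
  \<open>n\<close>-th one; the heights sum to 1, and each step survives in the sum because all the
  others are nondecreasing.\<close>

lemma mono_jumping_on_countable:
  fixes S :: "real set"
  assumes "countable S"
  obtains u :: "real \<Rightarrow> real" where "mono u" "\<And>x. 0 \<le> u x" "\<And>x. u x \<le> 1"
    "\<And>s. s \<in> S \<Longrightarrow> \<exists>c>0. \<forall>y>s. u s + c \<le> u y"
proof -
  \<comment> \<open>Only \<open>S \<subseteq> range q\<close> is asked, which also covers empty
    \<open>S\<close>; surplus or repeated values merely add further steps.\<close>
  obtain q :: "nat \<Rightarrow> real" where q: "S \<subseteq> range q"
  proof -
    have "S \<subseteq> range (from_nat_into S)"
      using assms by (cases "S = {}") (simp_all add: range_from_nat_into)
    then show thesis by (rule that)
  qed
  \<comment> \<open>The rays are open, so the step at \<open>q n\<close> is not yet counted in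
    \<open>u (q n)\<close> and the jump lies strictly to its right.\<close>
  define u where "u x = (\<Sum>n. (1/2)^Suc n * indicat_real {q n<..} x)" for x
  have geom: "(\<lambda>n. (1/2::real)^Suc n) sums 1"
    by (rule power_half_series)
  have summ: "summable (\<lambda>n. (1/2)^Suc n * indicat_real {q n<..} x)" for x
    by (rule summable_comparison_test'[OF sums_summable[OF geom]]) (auto simp: indicator_def)
  \<comment> \<open>All terms of the series for \<open>u y - u x\<close> are nonnegative, so the
    \<open>n\<close>-th one alone is a lower bound.\<close>
  have step: "u x + (1/2)^Suc n * (indicat_real {q n<..} y - indicat_real {q n<..} x) \<le> u y"
    if "x \<le> y" for x y n
  proof -
    let ?g = "\<lambda>n. (1/2)^Suc n * indicat_real {q n<..} y - (1/2)^Suc n * indicat_real {q n<..} x"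
    have "sum ?g {n} \<le> suminf ?g"
      using summ that by (intro sum_le_suminf summable_diff) (auto simp: indicator_def)
    then show ?thesis
      using suminf_diff[OF summ[of y] summ[of x]]
      by (simp add: u_def[symmetric] right_diff_distrib del: power_Suc)
  qed
  show thesis
  proof (rule that[of u])
    have "u x \<le> u y" if "x \<le> y" for x y
      using step[OF that, of 0] that by (cases "q 0 < x"; cases "q 0 < y") auto
    then show "mono u" by (rule monoI)
    show "0 \<le> u x" for x
      unfolding u_def by (intro suminf_nonneg summ) auto
    show "u x \<le> 1" for x
      unfolding u_def
      by (rule sums_le[OF _ summable_sums[OF summ] geom]) (auto simp: indicator_def)
    show "\<exists>c>0. \<forall>y>s. u s + c \<le> u y" if "s \<in> S" for s
    proof -
      obtain n where n: "s = q n" using \<open>s \<in> S\<close> q by blast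
      have "u s + (1/2)^Suc n \<le> u y" if "s < y" for y
        using step[of s y n] that by (simp add: n)
      then show ?thesis
        by (intro exI[of _ "(1/2)^Suc n"]) simp
    qed
  qed
qed

section \<open>Primitives of bounded Borel functions on the line\<close>

lemma borel_measurable_lebesgue_on:
  fixes f :: "'a::euclidean_space \<Rightarrow> 'b::euclidean_space"
  assumes "f \<in> borel_measurable borel"
  shows "f \<in> borel_measurable (lebesgue_on S)"
  using assms by (intro measurable_restrict_space1 measurable_completion) simp

lemma bounded_borel_primitive:
  fixes w :: "real \<Rightarrow> real"
  assumes "w \<in> borel_measurable borel" "\<And>x. \<bar>w x\<bar> \<le> B"
  obtains a where "\<And>x y. x \<le> y \<Longrightarrow> (w has_integral (a y - a x)) {x..y}"
proof -
  have w: "w integrable_on {x..y}" for x y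
    by (rule measurable_bounded_by_integrable_imp_integrable[where g = "\<lambda>_. B"])
      (use assms in \<open>auto intro: borel_measurable_lebesgue_on\<close>)
  \<comment> \<open>the oriented integral from 0 to x: at most one of the two intervals is nondegenerate\<close>
  define a where "a x = integral {0..x} w - integral {x..0} w" for x
  have "integral {x..y} w = a y - a x" if "x \<le> y" for x y
  proof -
    consider "0 \<le> x" | "x < 0" "0 \<le> y" | "y < 0" by linarith
    then show ?thesis
    proof cases
      case 1
      moreover have "{x..0} = (if x = 0 then {0} else {})" "{y..0} = (if y = 0 then {0} else {})"
        using 1 that by auto
      ultimately show ?thesis
        using Henstock_Kurzweil_Integration.integral_combine[of 0 x y w] w that by (auto simp: a_def)
    next
      case 2
      moreover have "{y..0} = (if y = 0 then {0} else {})"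
        using 2 by auto
      ultimately show ?thesis
        using Henstock_Kurzweil_Integration.integral_combine[of x 0 y w] w by (auto simp: a_def)
    next
      case 3
      then show ?thesis
        using Henstock_Kurzweil_Integration.integral_combine[of x y 0 w] w that by (simp add: a_def)
    qed
  qed
  then show thesis
    using that w by (metis integrable_integral)
qed

lemma primitive_Lipschitz:
  fixes w a :: "real \<Rightarrow> real"
  assumes a: "\<And>x y. x \<le> y \<Longrightarrow> (w has_integral (a y - a x)) {x..y}"
    and w: "\<And>x. \<bar>w x\<bar> \<le> B"
  shows "\<bar>a y - a x\<bar> \<le> B * \<bar>y - x\<bar>"
proof -
  have B: "0 \<le> B" using w[of 0] by simp
  have le: "\<bar>a y - a x\<bar> \<le> B * \<bar>y - x\<bar>" if "x \<le> y" for x y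
    using has_integral_bound_real[OF B finite.emptyI a[OF that]] w that by auto
  show ?thesis
    using le[of x y] le[of y x] by (cases "x \<le> y") (auto simp: abs_minus_commute)
qed

lemma primitive_has_derivative:
  fixes w a :: "real \<Rightarrow> real"
  assumes a: "\<And>x y. x \<le> y \<Longrightarrow> (w has_integral (a y - a x)) {x..y}"
    and w: "isCont w x"
  shows "(a has_real_derivative w x) (at x)"
proof -
  have "((\<lambda>u. integral {x-1..u} w) has_vector_derivative w x) (at x within {x-1..x+1} - {})"
    by (rule integral_has_vector_derivative_continuous_at)
      (use a[of "x-1" "x+1"] w continuous_at_imp_continuous_within in \<open>auto simp: integrable_on_def\<close>)
  then have "((\<lambda>u. integral {x-1..u} w) has_vector_derivative w x) (at x within {x-1<..<x+1})"
    by (rule has_vector_derivative_within_subset) auto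
  then have "((\<lambda>u. integral {x-1..u} w) has_real_derivative w x) (at x)"
    using at_within_open[of x "{x-1<..<x+1}"]
    unfolding has_real_derivative_iff_has_vector_derivative by simp
  then have "((\<lambda>u. a (x-1) + integral {x-1..u} w) has_real_derivative w x) (at x)"
    by (auto intro!: derivative_eq_intros)
  then show ?thesis
  proof (rule has_field_derivative_transform_within_open[of _ _ _ "{x-1<..}"])
    show "a (x-1) + integral {x-1..y} w = a y" if "y \<in> {x-1<..}" for y
      using integral_unique[OF a[of "x-1" y]] that by simp
  qed auto
qed

text \<open>Difference quotients of \<open>a\<close> at \<open>s\<close> are averages of
  \<open>u\<close>: at most \<open>u s\<close> from the left, at least \<open>u s + c\<close> from
  the right, so no common limit exists.\<close>

lemma primitive_not_differentiable_at_jump: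
  fixes u a :: "real \<Rightarrow> real"
  assumes a: "\<And>x y. x \<le> y \<Longrightarrow> (u has_integral (a y - a x)) {x..y}"
    and u: "mono u" and c: "0 < c" "\<And>y. s < y \<Longrightarrow> u s + c \<le> u y"
  shows "\<not> (a has_real_derivative D) (at s)"
proof
  assume D: "(a has_real_derivative D) (at s)"
  then have lim: "((\<lambda>y. (a y - a s) / (y - s)) \<longlongrightarrow> D) (at s)"
    by (simp add: has_field_derivative_iff)
  have "(a y - a s) / (y - s) \<le> u s" if "y < s" for y
  proof -
    have "((\<lambda>_. u s) has_integral (s - y) * u s) {y..s}"
      using has_integral_const_real[of "u s" y s] that by simp
    then have "a s - a y \<le> (s - y) * u s"
      by (rule has_integral_le[OF a[OF less_imp_le[OF that]]]) (use u in \<open>auto dest: monoD\<close>)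
    then show ?thesis
      using that by (simp add: field_simps)
  qed
  then have "eventually (\<lambda>y. (a y - a s) / (y - s) \<le> u s) (at_left s)"
    by (auto simp: eventually_at_filter)
  then have "D \<le> u s"
    using tendsto_upperbound[OF tendsto_within_subset[OF lim subset_UNIV]] by simp
  moreover have "u s + c \<le> (a y - a s) / (y - s)" if "s < y" for y
  proof -
    have "((\<lambda>_. u s + c) has_integral (y - s) * (u s + c)) {s..y}"
      using has_integral_const_real[of "u s + c" s y] that by simp
    \<comment> \<open>The bound \<open>u s + c \<le> u t\<close> fails at \<open>t = s\<close>
      itself, so the integrand is changed at that single point.\<close>
    moreover have "((\<lambda>t. if t = s then u s + c else u t) has_integral (a y - a s)) {s..y}"
      by (rule has_integral_spike[of "{s}", OF _ _ a]) (use that in auto)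
    ultimately have "(y - s) * (u s + c) \<le> a y - a s"
      by (rule has_integral_le) (use c in auto)
    then show ?thesis
      using that by (simp add: field_simps)
  qed
  then have "eventually (\<lambda>y. u s + c \<le> (a y - a s) / (y - s)) (at_right s)"
    by (auto simp: eventually_at_filter)
  then have "u s + c \<le> D"
    using tendsto_lowerbound[OF tendsto_within_subset[OF lim subset_UNIV]] by simp
  ultimately show False
    using c(1) by simp
qed

text \<open>Each value of the coordinate cuts out a hyperplane, which is null, and countably many
  null sets are discarded. This turns countably many bad parameters of the curve into a null set in
  the plane.\<close>

lemma AE_component_notin_countable:
  fixes S :: "real set"
  assumes "countable S"
  shows "AE x in lborel. (x :: real^'n) $ k \<notin> S"
proof -
  have "AE x in lborel. (x :: real^'n) $ k \<noteq> s" for s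
  proof -
    have "negligible {x :: real^'n. axis k 1 \<bullet> x = s}"
      by (rule negligible_hyperplane) (simp add: axis_eq_0_iff)
    then have "{x :: real^'n. axis k 1 \<bullet> x = s} \<in> null_sets lebesgue"
      by (simp add: negligible_iff_null_sets)
    then have "AE x in lebesgue. (x :: real^'n) $ k \<noteq> s"
      by (rule AE_I') (auto simp: cart_eq_inner_axis inner_commute)
    then show ?thesis
      by (simp add: AE_completion_iff)
  qed
  then have "AE x in lborel. \<forall>s\<in>S. (x :: real^'n) $ k \<noteq> s"
    using assms by (simp add: AE_ball_countable)
  then show ?thesis
    by eventually_elim auto
qed

section \<open>The solution\<close>

text \<open>This is the case \<open>g = diag(2, 1)\<close>. Since \<open>det X = 0\<close>, the
  cofactor term of the gradient drops out and \<open>X\<close> enters only through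
  \<open>transpose X ** X\<close>, which the unit length of the first column fixes.\<close>

lemma Bmap_unit_first_column:
  assumes "X $ 1 $ 2 = 0" "X $ 2 $ 2 = 0" "(X $ 1 $ 1)\<^sup>2 + (X $ 2 $ 1)\<^sup>2 = 1"
  shows "Bmap X = (1 / sqrt 2) *\<^sub>R vector [vector [0, -1], vector [2, 0]]"
proof -
  have det: "det X = 0"
    using assms by (simp add: det_2)
  have norm: "(norm X)\<^sup>2 = 1"
    unfolding power2_norm_eq_inner inner_mat2 using assms by (simp add: power2_eq_square)
  have area: "area X = sqrt 2"
    by (simp add: area_def det norm)
  have grad: "grad_area X = (1 / sqrt 2) *\<^sub>R X"
    using grad_area_eq[OF GDERIV_area_explicit] by (simp add: area det)
  have "transpose X ** X = vector [vector [1, 0], vector [0, 0]]"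
    using assms by (simp add: vec_eq_iff forall_2 matrix_matrix_mult_def sum_2 transpose_def power2_eq_square)
  moreover have "A ** (k *\<^sub>R B) ** C = k *\<^sub>R (A ** B ** C)" for A B C :: "real^2^2" and k
    by (metis matrix_scalar_ac scalar_matrix_assoc)
  ultimately have "Bmap X = (1 / sqrt 2) *\<^sub>R (vector [vector [1, 0], vector [0, 0]] ** Jmat)
      - sqrt 2 *\<^sub>R Jmat"
    unfolding Bmap_def grad area by simp
  then show ?thesis
    by (simp add: vec_eq_iff forall_2 matrix_matrix_mult_def sum_2 Jmat_def real_div_sqrt field_simps)
qed

section \<open>Integrability of bounded fields, continuous representatives, density of the
  kinks\<close>

lemma Lp_on_bounded:
  fixes f :: "real^2 \<Rightarrow> 'b::euclidean_space"
  assumes "open \<Omega>" "bounded \<Omega>" "f \<in> borel_measurable borel"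
    and B: "\<And>x. x \<in> \<Omega> \<Longrightarrow> norm (f x) \<le> B" and "0 \<le> p"
  shows "f \<in> Lp_on p \<Omega>"
proof -
  have \<Omega>: "\<Omega> \<in> lmeasurable"
    using assms by (simp add: lmeasurable_open)
  have f: "f \<in> borel_measurable (lebesgue_on \<Omega>)"
    using assms(3) by (auto intro: borel_measurable_lebesgue_on)
  have "integrable (lebesgue_on \<Omega>) (\<lambda>x. norm (f x) powr p)"
  proof (rule finite_measure.integrable_const_bound[where B = "B powr p"])
    show "finite_measure (lebesgue_on \<Omega>)"
      using \<Omega> by (rule finite_measure_lebesgue_on)
    show "AE x in lebesgue_on \<Omega>. norm (norm (f x) powr p) \<le> B powr p"
      using B \<open>0 \<le> p\<close> by (intro AE_I2) (auto intro!: powr_mono2)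
    show "(\<lambda>x. norm (f x) powr p) \<in> borel_measurable (lebesgue_on \<Omega>)"
      using f by measurable
  qed
  with f show ?thesis
    by (simp add: Lp_on_def)
qed

lemma loc_integrable_locally_bounded:
  fixes f :: "real^2 \<Rightarrow> 'b::euclidean_space"
  assumes "f \<in> borel_measurable borel" "\<And>K. compact K \<Longrightarrow> bounded (f ` K)"
  shows "loc_integrable \<Omega> f"
  unfolding loc_integrable_def
proof (intro allI impI, elim conjE)
  fix K :: "(real^2) set" assume K: "compact K"
  from assms(2)[OF K] obtain B where "\<And>x. x \<in> K \<Longrightarrow> norm (f x) \<le> B"
    unfolding bounded_iff by auto
  then show "f absolutely_integrable_on K"
    by (intro measurable_bounded_by_integrable_imp_absolutely_integrable[where g = "\<lambda>_. B"])
      (use assms(1) K lmeasurable_compact[OF K] in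
        \<open>auto intro: borel_measurable_lebesgue_on integrable_on_const\<close>)
qed

text \<open>The set where the functions differ is open and null, hence empty. Thus a
  \<open>C\<^sup>1\<close> representative can only be the continuous map itself.\<close>

lemma ae_eq_continuous_imp_eq:
  fixes f g :: "'a::euclidean_space \<Rightarrow> 'b::real_normed_vector"
  assumes "open V" "continuous_on V f" "continuous_on V g" "AE x in lebesgue_on V. f x = g x"
    and "x \<in> V"
  shows "f x = g x"
proof -
  define W where "W = {y \<in> V. f y - g y \<in> - {0}}"
  have "open W"
    using continuous_open_preimage[OF continuous_on_diff[OF assms(2,3)] assms(1), of "- {0}"]
    by (simp add: W_def vimage_def Int_def open_delete Compl_eq_Diff_UNIV)
  have "AE y in lebesgue. y \<in> V \<longrightarrow> f y = g y"
    using assms(1,4) by (simp add: AE_restrict_space_iff)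
  then have "AE y in lebesgue. y \<notin> W"
    by eventually_elim (auto simp: W_def)
  moreover have "W \<in> sets lebesgue"
    using \<open>open W\<close> by auto
  ultimately have "negligible W"
    by (simp add: AE_iff_null_sets negligible_iff_null_sets)
  then have "W = {}"
    using open_not_negligible[OF \<open>open W\<close>] by blast
  then show ?thesis
    using assms(5) by (auto simp: W_def)
qed

text \<open>A small move along the \<open>k\<close>-th axis reaches a rational coordinate, so every
  nonempty open set meets a line of kinks.\<close>

lemma open_contains_rational_component:
  fixes V :: "(real^'n) set"
  assumes "open V" "V \<noteq> {}"
  obtains x where "x \<in> V" "x $ k \<in> \<rat>"
proof -
  obtain z where z: "z \<in> V" using assms by auto
  have "open ((\<lambda>t. z + t *\<^sub>R axis k 1) -` V)"
    by (rule open_vimage[OF assms(1)]) (intro continuous_intros)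
  moreover have "0 \<in> (\<lambda>t. z + t *\<^sub>R axis k 1) -` V"
    using z by simp
  ultimately obtain e where e: "0 < e" "ball 0 e \<subseteq> (\<lambda>t. z + t *\<^sub>R axis k 1) -` V"
    by (metis open_contains_ball)
  obtain q where q: "q \<in> \<rat>" "z $ k < q" "q < z $ k + e"
    using Rats_dense_in_real[of "z $ k" "z $ k + e"] e(1) by auto
  show thesis
  proof (rule that)
    show "z + (q - z $ k) *\<^sub>R axis k 1 \<in> V"
      using e(2) q by (force simp: dist_norm)
    show "(z + (q - z $ k) *\<^sub>R axis k 1) $ k \<in> \<rat>"
      using q(1) by simp
  qed
qed

theorem theorem7p1:
  fixes \<Omega> :: "(real^2) set"
  assumes "open \<Omega>" and "bounded \<Omega>"
  shows "\<exists>p>2. \<exists>\<psi>\<in>W1p p \<Omega>.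
           (\<exists>D\<psi>. has_weak_jacobian \<Omega> \<psi> D\<psi> \<and> curl_free \<Omega> (\<lambda>x. Bmap (D\<psi> x))) \<and>
           (\<forall>V. open V \<and> V \<noteq> {} \<and> V \<subseteq> \<Omega> \<longrightarrow> \<not> ae_C1_on V \<psi>)"
proof -
  obtain u :: "real \<Rightarrow> real" where u: "mono u" "\<And>x. 0 \<le> u x" "\<And>x. u x \<le> 1"
    and jump: "\<And>s. s \<in> \<rat> \<Longrightarrow> \<exists>c>0. \<forall>y>s. u s + c \<le> u y"
    using mono_jumping_on_countable[OF countable_rat] by blast
  \<comment> \<open>\<open>w\<close> is \<open>\<gamma>'\<close>: the second component completes
    \<open>u\<close> to a unit vector. Its primitive \<open>a\<close>, obtained below, is
    \<open>\<gamma>\<close>.\<close>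
  define w :: "2 \<Rightarrow> real \<Rightarrow> real" where "w i t = (if i = 1 then u t else sqrt (1 - (u t)\<^sup>2))" for i t
  have u2: "(u t)\<^sup>2 \<le> 1" for t
    using u by (simp add: power_le_one)
  have w_bound: "\<bar>w i t\<bar> \<le> 1" for i t
    using u u2 by (simp add: w_def)
  have w_sum: "(w 1 t)\<^sup>2 + (w 2 t)\<^sup>2 = 1" for t
    using u2[of t] by (simp add: w_def)
  have [measurable]: "u \<in> borel_measurable borel"
    using u(1) by (rule borel_measurable_mono)
  have w_meas [measurable]: "w i \<in> borel_measurable borel" for i
    unfolding w_def[abs_def] by (cases "i = 1") simp_all
  have w_cont: "isCont (w i) t" if "isCont u t" for i t
    unfolding w_def[abs_def] using that by (cases "i = 1") (auto intro!: continuous_intros)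
  have "\<exists>a. \<forall>x y. x \<le> y \<longrightarrow> (w i has_integral (a y - a x)) {x..y}" for i
    using bounded_borel_primitive[OF w_meas w_bound] by metis
  then obtain a where a: "\<And>i x y. x \<le> y \<Longrightarrow> (w i has_integral (a i y - a i x)) {x..y}"
    by metis
  have a_lip: "\<bar>a i y - a i x\<bar> \<le> 1 * \<bar>y - x\<bar>" for i x y
    by (rule primitive_Lipschitz[OF a w_bound])
  have a_cont: "continuous_on UNIV (a i)" for i
    using a_lip by (intro lipschitz_on_continuous_on[of 1] lipschitz_onI) (auto simp: dist_real_def)
  define \<psi> :: "real^2 \<Rightarrow> real^2" where "\<psi> x = (\<chi> i. a i (x $ 1))" for x
  define G :: "real^2 \<Rightarrow> real^2^2" where "G x = (\<chi> i j. if j = 1 then w i (x $ 1) else 0)" for x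
  have nth_meas [measurable]: "(\<lambda>x::real^2. x $ k) \<in> borel_measurable borel" for k
    by (intro borel_measurable_continuous_onI continuous_intros)
  have ai_cont: "continuous_on UNIV (\<lambda>x::real^2. a i (x $ 1))" for i
    by (rule continuous_on_compose2[OF a_cont]) (auto intro: continuous_intros)
  have \<psi>_cont: "continuous_on UNIV \<psi>"
    unfolding \<psi>_def by (intro continuous_on_vec_lambda ai_cont)
  have \<psi>_meas: "\<psi> \<in> borel_measurable borel"
    using \<psi>_cont by (rule borel_measurable_continuous_onI)
  \<comment> \<open>Writing the matrix field as a finite sum of scalar functions times constant
    matrices reduces its measurability to that of \<open>w i\<close>.\<close>
  have G_eq: "G x = (\<Sum>i\<in>UNIV. w i (x $ 1) *\<^sub>R axis i (axis 1 1))" for x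
    by (simp add: G_def vec_eq_iff forall_2 sum_2 axis_def)
  have G_meas: "G \<in> borel_measurable borel"
    unfolding G_eq[abs_def] by measurable
  have G_norm: "norm (G x) \<le> 1" for x
  proof -
    have "(norm (G x))\<^sup>2 = 1"
      using w_sum[of "x $ 1"]
      unfolding power2_norm_eq_inner inner_mat2 by (simp add: G_def power2_eq_square)
    then have "norm (G x) = 1 \<or> norm (G x) = -1"
      by (simp add: power2_eq_1_iff)
    then show ?thesis
      by linarith
  qed
  have jac: "has_weak_jacobian \<Omega> \<psi> G"
    unfolding has_weak_jacobian_def
  proof (intro conjI ballI allI)
    show "loc_integrable \<Omega> \<psi>"
      using \<psi>_meas continuous_on_subset[OF \<psi>_cont]
      by (intro loc_integrable_locally_bounded compact_imp_bounded compact_continuous_image) auto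
    show "loc_integrable \<Omega> G"
      using G_meas G_norm
      by (intro loc_integrable_locally_bounded) (auto simp: bounded_iff)
    fix \<phi> i j assume \<phi>: "\<phi> \<in> test_functions \<Omega>"
    show "dist_partial \<Omega> j (\<lambda>x. \<psi> x $ i) \<phi> = (LINT x:\<Omega>|lebesgue. G x $ i $ j * \<phi> x)"
    proof (rule dist_partial_Lipschitz[OF _ _ _ _ _ \<phi>, of _ _ 1])
      show "continuous_on UNIV (\<lambda>x. \<psi> x $ i)"
        using ai_cont by (simp add: \<psi>_def)
      show "\<bar>\<psi> (x + t *\<^sub>R axis j 1) $ i - \<psi> x $ i\<bar> \<le> 1 * \<bar>t\<bar>" for x t
        using a_lip[of i "x $ 1 + t" "x $ 1"] by (auto simp: \<psi>_def axis_def)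
      show "(\<lambda>x. G x $ i $ j) \<in> borel_measurable borel"
        by (cases "j = 1") (simp_all add: G_def)
      show "\<bar>G x $ i $ j\<bar> \<le> 1" for x
        using w_bound by (simp add: G_def)
      \<comment> \<open>A monotone function has only countably many discontinuities. Off them the
        classical derivative exists for \<open>j = 1\<close>; for \<open>j = 2\<close> both
        \<open>\<psi>\<close> along the axis and the entry of \<open>G\<close> are trivial.\<close>
      have "AE x in lborel. (x :: real^2) $ 1 \<notin> {t. \<not> isCont u t}"
        by (rule AE_component_notin_countable[OF mono_ctble_discont[OF u(1)]])
      then show "AE x in lborel. ((\<lambda>t. \<psi> (x + t *\<^sub>R axis j 1) $ i) has_real_derivative
          G x $ i $ j) (at 0)"
      proof eventually_elim
        case (elim x)
        then have "(a i has_real_derivative w i (x $ 1)) (at (x $ 1))"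
          by (intro primitive_has_derivative a w_cont) auto
        then have "((\<lambda>t. a i (x $ 1 + t)) has_real_derivative w i (x $ 1)) (at 0)"
          using DERIV_shift[of "a i" "w i (x $ 1)" 0 "x $ 1"] by (simp add: add.commute)
        then show ?case
          by (cases "j = 1") (simp_all add: \<psi>_def G_def axis_def)
      qed
    qed
  qed
  \<comment> \<open>Every \<open>G x\<close> has a unit first column and zero second column, so the
    field is constant and its distributional curl vanishes.\<close>
  obtain C where C: "\<And>x. Bmap (G x) = C"
    using Bmap_unit_first_column w_sum by (simp add: G_def)
  have curl: "curl_free \<Omega> (\<lambda>x. Bmap (G x))"
    unfolding curl_free_def dist_curl_def C
    using loc_integrable_locally_bounded[of "\<lambda>_. C"]
    by (auto simp: dist_partial_const bounded_iff)
  have "\<exists>B. \<forall>x\<in>\<Omega>. norm (\<psi> x) \<le> B"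
  proof -
    have "compact (\<psi> ` closure \<Omega>)"
      using assms(2) continuous_on_subset[OF \<psi>_cont]
      by (intro compact_continuous_image) auto
    then have "bounded (\<psi> ` closure \<Omega>)"
      by (rule compact_imp_bounded)
    then show ?thesis
      using closure_subset[of \<Omega>] by (auto simp: bounded_iff)
  qed
  \<comment> \<open>The exponent 3 is an arbitrary choice above 2: \<open>\<psi>\<close> and
    \<open>G\<close> are bounded on \<open>\<Omega>\<close>, which has finite measure.\<close>
  then have "\<psi> \<in> Lp_on 3 \<Omega>"
    using Lp_on_bounded[OF assms \<psi>_meas, where p = 3] by auto
  moreover have "G \<in> Lp_on 3 \<Omega>"
    by (rule Lp_on_bounded[OF assms G_meas G_norm]) simp
  ultimately have W: "\<psi> \<in> W1p 3 \<Omega>"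
    using jac unfolding W1p_def by blast
  \<comment> \<open>Differentiability of a representative at one point with rational first
    coordinate is already contradictory.\<close>
  have "\<not> ae_C1_on V \<psi>" if V: "open V" "V \<noteq> {}" for V
  proof
    assume "ae_C1_on V \<psi>"
    then obtain g where g: "\<And>x. x \<in> V \<Longrightarrow> g differentiable (at x)"
        "AE x in lebesgue_on V. \<psi> x = g x"
      by (auto simp: ae_C1_on_def)
    have "continuous_on V g"
      using g(1) by (meson continuous_at_imp_continuous_on differentiable_imp_continuous_within)
    then have eq: "\<psi> x = g x" if "x \<in> V" for x
      using ae_eq_continuous_imp_eq[OF V(1) continuous_on_subset[OF \<psi>_cont] _ g(2) that] by simp
    obtain x where x: "x \<in> V" "x $ 1 \<in> \<rat>"
      using open_contains_rational_component[OF V] by blast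
    obtain g' where g': "(g has_derivative g') (at x)"
      using g(1)[OF x(1)] by (auto simp: differentiable_def)
    have \<psi>': "(\<psi> has_derivative g') (at x)"
      using has_derivative_transform_within_open[OF g' V(1) x(1)] eq by simp
    \<comment> \<open>The line through \<open>x\<close> along the first axis, parametrised by its
      first coordinate, so that the first component of \<open>\<psi>\<close> along it is exactly
      \<open>a 1\<close>.\<close>
    let ?l = "\<lambda>t. x + (t - x $ 1) *\<^sub>R (axis 1 1 :: real^2)"
    have "(?l has_derivative (\<lambda>t. t *\<^sub>R axis 1 1)) (at (x $ 1))"
      by (auto intro!: derivative_eq_intros)
    moreover have "(\<psi> has_derivative g') (at (?l (x $ 1)))"
      using \<psi>' by simp
    ultimately have "((\<lambda>t. \<psi> (?l t)) has_derivative (\<lambda>t. g' (t *\<^sub>R axis 1 1))) (at (x $ 1))"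
      by (rule has_derivative_compose)
    then have "((\<lambda>t. \<psi> (?l t) $ 1) has_derivative (\<lambda>t. g' (t *\<^sub>R axis 1 1) $ 1)) (at (x $ 1))"
      by (rule bounded_linear.has_derivative[OF bounded_linear_vec_nth])
    then have "(a 1 has_derivative (\<lambda>t. t * g' (axis 1 1) $ 1)) (at (x $ 1))"
      using linear_scale[OF has_derivative_linear[OF \<psi>']] by (simp add: \<psi>_def)
    then have D: "(a 1 has_real_derivative g' (axis 1 1) $ 1) (at (x $ 1))"
      by (simp add: has_field_derivative_def mult_commute_abs)
    obtain c where c: "0 < c" "\<And>y. x $ 1 < y \<Longrightarrow> u (x $ 1) + c \<le> u y"
      using jump[OF x(2)] by blast
    have "w 1 = u"
      by (simp add: w_def fun_eq_iff)
    then have a1: "(u has_integral (a 1 y - a 1 x)) {x..y}" if "x \<le> y" for x y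
      using a[OF that, of 1] by simp
    show False
      using primitive_not_differentiable_at_jump[OF a1 u(1) c] D by (rule notE)
  qed
  with W jac curl show ?thesis
    by (intro exI[of _ "3::real"] conjI bexI[of _ \<psi>]) auto
qed

end
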